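(* Let $G$ be a connected graph with vertex set $[\ell]=\{1,\dots,\ell\}$. (1) $P_G$ is a normal pseudomanifold of rank $\ell-1$ whose dual graph is $G$ (where the facet $(\{i\},[\ell]\setminus\{i\})$ of $P_G$ is identified with the vertex $i$ of $G$). (2) An element $\sigma=(W,T)\in P_G$ is an interior face of $P_G$ if and only if $W$ is a clique of $G$ and $T=[\ell]\setminus W$.
   Context: Graphs are finite and simple, $\ell\ge1$. $W\subset V(G)$ is a clique of $G$ if the induced subgraph $G[W]$ is complete. $P_G=\{(V(C),T)\mid T\subsetneq[\ell],\ C \text{ a connected component of } G-T\}$, where $G-T$ is obtained from $G$ by deleting the vertices in $T$ and $V(C)$ is the vertex set of $C$; order: $(W,T)\le(W',T')$ iff $W\supset W'$ and $T\subset T'$. For connected $G$, $P_G$ is a simplicial poset. A simplicial poset is a finite poset $P$ with minimal element $\hat0$ such that each interval $[\hat0,\sigma]$ is a Boolean algebra; $\mathrm{rank}(\sigma)$ is the rank of this Boolean algebra, and the rank of $P$ is the maximum rank of its elements. $P$ is the face poset (with $\hat0$ as the empty face) of a regular CW-complex $\Gamma(P)$; $P$ is called connected if $\Gamma(P)$ is connected. For $\sigma\in P$, $\mathrm{lk}_P(\sigma)=\{\tau\in P\mid\tau\ge\sigma\}$, a simplicial poset with minimal element $\sigma$. Maximal elements of $P$ are called facets; $P$ is pure if all facets have the same rank. The dual graph of a pure simplicial poset $P$ of rank $r$ is the graph whose vertices are the facets of $P$, two facets being adjacent if there is a rank $r-1$ element covered by both. A pure simplicial poset $P$ of rank $r$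 is a pseudomanifold if every rank $r-1$ element is covered by at most two elements and the dual graph of $P$ is connected. It is without boundary if moreover every rank $r-1$ element is covered by exactly two elements, and with boundary otherwise. A pseudomanifold of rank $r$ is normal if $\mathrm{lk}_P(\sigma)$ is connected for all $\sigma\in P$ with $\mathrm{rank}(\sigma)\le r-2$. For a normal pseudomanifold $P$ and $\sigma\in P$, the link $\mathrm{lk}_P(\sigma)$ is again a normal pseudomanifold, and $\sigma$ is called an interior face of $P$ if $\mathrm{lk}_P(\sigma)$ is a normal pseudomanifold without boundary (facets are regarded as interior faces). *)

theory Defs
  imports "HOL-Analysis.Analysis" "Graph_Theory.Graph_Theory"
begin

section \<open>Simplicial posets\<close>

text \<open>A poset is a carrier set \<open>P\<close> together with a relation \<open>le\<close> that is only looked at on \<open>P\<close>.\<close>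

definition is_least :: "'a set \<Rightarrow> ('a \<Rightarrow> 'a \<Rightarrow> bool) \<Rightarrow> 'a \<Rightarrow> bool" where
  "is_least P le z \<longleftrightarrow> z \<in> P \<and> (\<forall>x\<in>P. le z x)"

definition least_elt :: "'a set \<Rightarrow> ('a \<Rightarrow> 'a \<Rightarrow> bool) \<Rightarrow> 'a" where
  "least_elt P le = (THE z. is_least P le z)"

definition interval :: "'a set \<Rightarrow> ('a \<Rightarrow> 'a \<Rightarrow> bool) \<Rightarrow> 'a \<Rightarrow> 'a \<Rightarrow> 'a set" where
  "interval P le x y = {z \<in> P. le x z \<and> le z y}"

text \<open>The Boolean algebra of rank \<open>n\<close> is the lattice of subsets of an \<open>n\<close>-element set.\<close>

definition boolean_of_rank :: "'a set \<Rightarrow> ('a \<Rightarrow> 'a \<Rightarrow> bool) \<Rightarrow> nat \<Rightarrow> bool" where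
  "boolean_of_rank B le n \<longleftrightarrow>
     (\<exists>f. bij_betw f B (Pow {..<n}) \<and> (\<forall>x\<in>B. \<forall>y\<in>B. le x y \<longleftrightarrow> f x \<subseteq> f y))"

definition simplicial_poset :: "'a set \<Rightarrow> ('a \<Rightarrow> 'a \<Rightarrow> bool) \<Rightarrow> bool" where
  "simplicial_poset P le \<longleftrightarrow>
     finite P \<and> reflp_on P le \<and> transp_on P le \<and> antisymp_on P le \<and>
     (\<exists>z. is_least P le z) \<and>
     (\<forall>\<sigma>\<in>P. \<exists>n. boolean_of_rank (interval P le (least_elt P le) \<sigma>) le n)"

definition rank :: "'a set \<Rightarrow> ('a \<Rightarrow> 'a \<Rightarrow> bool) \<Rightarrow> 'a \<Rightarrow> nat" where
  "rank P le \<sigma> = (THE n. boolean_of_rank (interval P le (least_elt P le) \<sigma>) le n)"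

definition poset_rank :: "'a set \<Rightarrow> ('a \<Rightarrow> 'a \<Rightarrow> bool) \<Rightarrow> nat" where
  "poset_rank P le = Max (rank P le ` P)"

definition link :: "'a set \<Rightarrow> ('a \<Rightarrow> 'a \<Rightarrow> bool) \<Rightarrow> 'a \<Rightarrow> 'a set" where
  "link P le \<sigma> = {\<tau> \<in> P. le \<sigma> \<tau>}"


section \<open>The CW complex of a simplicial poset\<close>

text \<open>
  \<open>\<Gamma>(P)\<close> is built by taking one closed simplex for each element of \<open>P\<close> and gluing these
  simplices along their faces as prescribed by the order. The simplex of \<open>\<sigma>\<close> is given in barycentric
  coordinates indexed by the rank 1 elements below \<open>\<sigma>\<close>; it carries the Euclidean topology, as
  functions with support in a fixed finite set under pointwise convergence. For the least element of
  \<open>P\<close> this simplex is empty, so that the cells of \<open>\<Gamma>(P)\<close> correspond to the other elements.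
\<close>

definition vertices_of :: "'a set \<Rightarrow> ('a \<Rightarrow> 'a \<Rightarrow> bool) \<Rightarrow> 'a \<Rightarrow> 'a set" where
  "vertices_of P le \<sigma> = {v \<in> P. rank P le v = 1 \<and> le v \<sigma>}"

definition closed_simplex :: "'a set \<Rightarrow> ('a \<Rightarrow> 'a \<Rightarrow> bool) \<Rightarrow> 'a \<Rightarrow> ('a \<Rightarrow> real) set" where
  "closed_simplex P le \<sigma> =
     {x. (\<forall>v. 0 \<le> x v) \<and> (\<forall>v. v \<notin> vertices_of P le \<sigma> \<longrightarrow> x v = 0) \<and>
         (\<Sum>v\<in>vertices_of P le \<sigma>. x v) = 1}"

definition simplex_sum :: "'a set \<Rightarrow> ('a \<Rightarrow> 'a \<Rightarrow> bool) \<Rightarrow> ('a \<times> ('a \<Rightarrow> real)) topology" where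
  "simplex_sum P le = sum_topology (\<lambda>\<sigma>. top_of_set (closed_simplex P le \<sigma>)) P"

text \<open>
  Two points are identified iff they are the same point of the simplex of a common face \<open>\<tau>\<close>.
  In a simplicial poset this is an equivalence relation: for transitivity, two faces of one
  \<open>\<sigma>\<close> meet in a face of \<open>\<sigma>\<close>, since the interval below \<open>\<sigma>\<close> is Boolean.
\<close>

definition gluing :: "'a set \<Rightarrow> ('a \<Rightarrow> 'a \<Rightarrow> bool) \<Rightarrow> ('a \<times> ('a \<Rightarrow> real)) rel" where
  "gluing P le =
     {((\<sigma>, x), (\<sigma>', x')). (\<sigma>, x) \<in> topspace (simplex_sum P le) \<and> (\<sigma>', x') \<in> topspace (simplex_sum P le) \<and>
        x = x' \<and> (\<exists>\<tau>\<in>P. le \<tau> \<sigma> \<and> le \<tau> \<sigma>' \<and> x \<in> closed_simplex P le \<tau>)}"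

definition quotient_topology :: "'b topology \<Rightarrow> ('b \<Rightarrow> 'c) \<Rightarrow> 'c topology" where
  "quotient_topology X q =
     topology (\<lambda>U. U \<subseteq> q ` topspace X \<and> openin X {x \<in> topspace X. q x \<in> U})"

definition CW_complex_of :: "'a set \<Rightarrow> ('a \<Rightarrow> 'a \<Rightarrow> bool) \<Rightarrow> ('a \<times> ('a \<Rightarrow> real)) set topology" where
  "CW_complex_of P le = quotient_topology (simplex_sum P le) (\<lambda>p. gluing P le `` {p})"

definition connected_poset :: "'a set \<Rightarrow> ('a \<Rightarrow> 'a \<Rightarrow> bool) \<Rightarrow> bool" where
  "connected_poset P le \<longleftrightarrow> connected_space (CW_complex_of P le)"

lemma openin_quotient_topology:
  "openin (quotient_topology X q) U \<longleftrightarrow>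
     U \<subseteq> q ` topspace X \<and> openin X {x \<in> topspace X. q x \<in> U}"
proof -
  have 1: "{x \<in> topspace X. q x \<in> S \<inter> T} = {x \<in> topspace X. q x \<in> S} \<inter> {x \<in> topspace X. q x \<in> T}" for S T
    by auto
  have 2: "{x \<in> topspace X. q x \<in> \<Union>\<K>} = (\<Union>K\<in>\<K>. {x \<in> topspace X. q x \<in> K})" for \<K>
    by auto
  have "istopology (\<lambda>U. U \<subseteq> q ` topspace X \<and> openin X {x \<in> topspace X. q x \<in> U})"
    unfolding istopology_def 1 2 by blast
  then show ?thesis
    by (simp add: quotient_topology_def)
qed

lemma topspace_quotient_topology: "topspace (quotient_topology X q) = q ` topspace X"
proof -
  have "{x \<in> topspace X. q x \<in> q ` topspace X} = topspace X"
    by auto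
  then have "openin (quotient_topology X q) (q ` topspace X)"
    by (simp add: openin_quotient_topology)
  then show ?thesis
    using openin_quotient_topology openin_subset openin_topspace by (metis subset_antisym)
qed

lemma quotient_map_quotient_topology: "quotient_map X (quotient_topology X q) q"
  by (auto simp: quotient_map_def topspace_quotient_topology openin_quotient_topology)


section \<open>Normal pseudomanifolds\<close>

definition facets :: "'a set \<Rightarrow> ('a \<Rightarrow> 'a \<Rightarrow> bool) \<Rightarrow> 'a set" where
  "facets P le = {\<sigma> \<in> P. \<forall>\<tau>\<in>P. le \<sigma> \<tau> \<longrightarrow> \<tau> = \<sigma>}"

definition pure :: "'a set \<Rightarrow> ('a \<Rightarrow> 'a \<Rightarrow> bool) \<Rightarrow> bool" where
  "pure P le \<longleftrightarrow> (\<forall>\<sigma>\<in>facets P le. \<forall>\<tau>\<in>facets P le. rank P le \<sigma> = rank P le \<tau>)"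

definition covered_by :: "'a set \<Rightarrow> ('a \<Rightarrow> 'a \<Rightarrow> bool) \<Rightarrow> 'a \<Rightarrow> 'a \<Rightarrow> bool" where
  "covered_by P le \<rho> \<sigma> \<longleftrightarrow>
     \<rho> \<in> P \<and> \<sigma> \<in> P \<and> le \<rho> \<sigma> \<and> \<rho> \<noteq> \<sigma> \<and> (\<forall>\<tau>\<in>P. le \<rho> \<tau> \<and> le \<tau> \<sigma> \<longrightarrow> \<tau> = \<rho> \<or> \<tau> = \<sigma>)"

text \<open>The condition is written as \<open>rank \<rho> + 1 = r\<close> so that there are no ridges when \<open>r = 0\<close>.\<close>

definition ridges :: "'a set \<Rightarrow> ('a \<Rightarrow> 'a \<Rightarrow> bool) \<Rightarrow> 'a set" where
  "ridges P le = {\<rho> \<in> P. rank P le \<rho> + 1 = poset_rank P le}"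

text \<open>Graphs are symmetric loop-free digraphs, each edge being represented by both its arcs.\<close>

definition dual_graph :: "'a set \<Rightarrow> ('a \<Rightarrow> 'a \<Rightarrow> bool) \<Rightarrow> 'a pair_pre_digraph" where
  "dual_graph P le =
     \<lparr>pverts = facets P le,
      parcs = {(\<sigma>, \<tau>). \<sigma> \<in> facets P le \<and> \<tau> \<in> facets P le \<and> \<sigma> \<noteq> \<tau> \<and>
                 (\<exists>\<rho>\<in>ridges P le. covered_by P le \<rho> \<sigma> \<and> covered_by P le \<rho> \<tau>)}\<rparr>"

definition pseudomanifold :: "'a set \<Rightarrow> ('a \<Rightarrow> 'a \<Rightarrow> bool) \<Rightarrow> bool" where
  "pseudomanifold P le \<longleftrightarrow>
     simplicial_poset P le \<and> pure P le \<and>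
     (\<forall>\<rho>\<in>ridges P le. card {\<sigma> \<in> P. covered_by P le \<rho> \<sigma>} \<le> 2) \<and>
     Digraph_Component.connected (with_proj (dual_graph P le))"

definition without_boundary :: "'a set \<Rightarrow> ('a \<Rightarrow> 'a \<Rightarrow> bool) \<Rightarrow> bool" where
  "without_boundary P le \<longleftrightarrow> (\<forall>\<rho>\<in>ridges P le. card {\<sigma> \<in> P. covered_by P le \<rho> \<sigma>} = 2)"

definition normal_pseudomanifold :: "'a set \<Rightarrow> ('a \<Rightarrow> 'a \<Rightarrow> bool) \<Rightarrow> bool" where
  "normal_pseudomanifold P le \<longleftrightarrow>
     pseudomanifold P le \<and>
     (\<forall>\<sigma>\<in>P. rank P le \<sigma> + 2 \<le> poset_rank P le \<longrightarrow> connected_poset (link P le \<sigma>) le)"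

definition interior_face :: "'a set \<Rightarrow> ('a \<Rightarrow> 'a \<Rightarrow> bool) \<Rightarrow> 'a \<Rightarrow> bool" where
  "interior_face P le \<sigma> \<longleftrightarrow>
     \<sigma> \<in> P \<and>
     (\<sigma> \<in> facets P le \<or>
      normal_pseudomanifold (link P le \<sigma>) le \<and> without_boundary (link P le \<sigma>) le)"


section \<open>The poset of a graph\<close>

definition connected_component :: "('a, 'b) pre_digraph \<Rightarrow> ('a, 'b) pre_digraph \<Rightarrow> bool" where
  "connected_component G C \<longleftrightarrow> pre_digraph.max_subgraph G Digraph_Component.connected C"

definition clique :: "'a pair_pre_digraph \<Rightarrow> 'a set \<Rightarrow> bool" where
  "clique G W \<longleftrightarrow> W \<subseteq> pverts G \<and> complete_digraph (card W) (with_proj G \<restriction> W)"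

definition graph_poset :: "'a pair_pre_digraph \<Rightarrow> ('a set \<times> 'a set) set" where
  "graph_poset G =
     {(verts C, T) | C T. T \<subset> pverts G \<and> connected_component (with_proj G \<restriction> (pverts G - T)) C}"

definition graph_poset_le :: "'a set \<times> 'a set \<Rightarrow> 'a set \<times> 'a set \<Rightarrow> bool" where
  "graph_poset_le = (\<lambda>(W, T) (W', T'). W' \<subseteq> W \<and> T \<subseteq> T')"

definition vertex_facet :: "'a pair_pre_digraph \<Rightarrow> 'a \<Rightarrow> 'a set \<times> 'a set" where
  "vertex_facet G i = ({i}, pverts G - {i})"

end

theory Submission
  imports Defs
begin

text \<open>
  Everything follows from a description of the link of an arbitrary element \<open>(W\<^sub>0, T\<^sub>0)\<close>; the
  whole poset is the link of its least element \<open>(V, {})\<close>, where \<open>V\<close> is the vertex set of \<open>G\<close>.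

  If \<open>T \<subseteq> T'\<close>, each component of \<open>G - T'\<close> lies in exactly one component of \<open>G - T\<close>. Hence an
  element \<open>\<rho>\<close> between \<open>(W\<^sub>0, T\<^sub>0)\<close> and \<open>(W, T)\<close> is determined by its second coordinate, which can be any
  set between \<open>T\<^sub>0\<close> and \<open>T\<close>: the interval is the Boolean algebra on \<open>T - T\<^sub>0\<close>
  (\<open>interval_boolean\<close>). Passing from \<open>(W, T)\<close> to \<open>({i}, V - {i})\<close> with \<open>i \<in> W\<close> shows that the facets of
  the link are the \<open>({i}, V - {i})\<close> with \<open>i \<in> W\<^sub>0\<close> (\<open>facets_link\<close>), so the link is pure of rank
  \<open>|V| - 1 - |T\<^sub>0|\<close>. A ridge \<open>(W, T)\<close> leaves two vertices \<open>a, b\<close> outside \<open>T\<close>, and the facets above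
  it are those of the vertices in \<open>W \<subseteq> {a, b}\<close> (\<open>covers_ridge\<close>): two if \<open>a\<close> and \<open>b\<close> are
  adjacent, one otherwise. Therefore the dual graph of the link is the subgraph induced on \<open>W\<^sub>0\<close>
  (\<open>dual_graph_link\<close>), which is connected because \<open>W\<^sub>0\<close> is a component of \<open>G - T\<^sub>0\<close>.

  Normality asks for connected CW complexes of links of rank at least 2. This is a general fact about
  simplicial posets with connected dual graph (\<open>connected_poset_if_dual_graph_connected\<close>): adjacent
  facets share a ridge, which has positive rank and so contains a vertex; the two closed simplices
  meet at that vertex, and connectedness propagates along paths in the dual graph.

  Finally, the link has no boundary iff no ridge in it is of the kind covered once, that is, iff every
  \<open>a \<in> W\<^sub>0\<close> is adjacent to every other \<open>b \<in> V - T\<^sub>0\<close> (\<open>without_boundary_link_iff\<close>). Such \<open>b\<close> then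
  lie in the component \<open>W\<^sub>0\<close> of \<open>a\<close>, so the condition says that \<open>T\<^sub>0 = V - W\<^sub>0\<close> and \<open>W\<^sub>0\<close> is a clique.
\<close>

section \<open>Simplicial posets with connected dual graph\<close>

lemma boolean_of_rank_unique:
  assumes "boolean_of_rank B le n" "boolean_of_rank B le m"
  shows "n = m"
proof -
  have "card B = 2 ^ k" if "boolean_of_rank B le k" for k
    using that unfolding boolean_of_rank_def
    by (metis bij_betw_same_card card_Pow card_lessThan finite_lessThan)
  with assms have "(2::nat) ^ n = 2 ^ m" by metis
  then show ?thesis by simp
qed

lemma boolean_of_rank_PowI:
  assumes "finite A" "bij_betw f B (Pow A)"
    and "\<And>x y. x \<in> B \<Longrightarrow> y \<in> B \<Longrightarrow> le x y \<longleftrightarrow> f x \<subseteq> f y"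
  shows "boolean_of_rank B le (card A)"
proof -
  obtain g where g: "bij_betw g A {..<card A}"
    using ex_bij_betw_finite_nat[OF assms(1)] by (auto simp: atLeast0LessThan)
  have "bij_betw ((`) g \<circ> f) B (Pow {..<card A})"
    using bij_betw_trans[OF assms(2) bij_betw_Pow[OF g]] .
  moreover have "le x y \<longleftrightarrow> ((`) g \<circ> f) x \<subseteq> ((`) g \<circ> f) y" if "x \<in> B" "y \<in> B" for x y
  proof -
    have "f x \<subseteq> A" "f y \<subseteq> A"
      using that bij_betwE[OF assms(2)] by auto
    then have "g ` f x \<subseteq> g ` f y \<longleftrightarrow> f x \<subseteq> f y"
      using inj_on_image_subset_iff[OF bij_betw_imp_inj_on[OF g]] by blast
    then show ?thesis using assms(3)[OF that] by simp
  qed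
  ultimately show ?thesis unfolding boolean_of_rank_def by blast
qed

lemma rank_eqI:
  assumes "boolean_of_rank (interval P le (least_elt P le) \<sigma>) le n"
  shows "rank P le \<sigma> = n"
  unfolding rank_def using assms boolean_of_rank_unique by blast

lemma least_elt_eqI:
  assumes "antisymp_on P le" "is_least P le z"
  shows "least_elt P le = z"
  unfolding least_elt_def
proof (rule the_equality)
  show "is_least P le z" by fact
next
  fix y assume "is_least P le y"
  then show "y = z"
    using assms by (auto simp: is_least_def dest: antisymp_onD)
qed

text \<open>
  Below an element of positive rank, an isomorphism with a power set provides an atom; the interval
  below an atom is the power set of a singleton, so the atom has rank 1.
\<close>

lemma vertex_below_of_rank_pos:
  assumes P: "simplicial_poset P le" and \<sigma>: "\<sigma> \<in> P" and pos: "rank P le \<sigma> > 0"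
  shows "vertices_of P le \<sigma> \<noteq> {}"
proof -
  let ?z = "least_elt P le"
  from P \<sigma> obtain n where n: "boolean_of_rank (interval P le ?z \<sigma>) le n"
    unfolding simplicial_poset_def by blast
  with pos have "0 < n" by (simp add: rank_eqI)
  from n obtain f where f: "bij_betw f (interval P le ?z \<sigma>) (Pow {..<n})"
    and mono: "\<And>x y. x \<in> interval P le ?z \<sigma> \<Longrightarrow> y \<in> interval P le ?z \<sigma> \<Longrightarrow> le x y \<longleftrightarrow> f x \<subseteq> f y"
    unfolding boolean_of_rank_def by blast
  from \<open>0 < n\<close> have "{0} \<in> Pow {..<n}" by simp
  with f obtain v where v: "v \<in> interval P le ?z \<sigma>" "f v = {0}"
    by (metis bij_betw_iff_bijections)
  have trans: "transp_on P le" using P by (simp add: simplicial_poset_def)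
  have sub: "interval P le ?z v = {x \<in> interval P le ?z \<sigma>. f x \<subseteq> {0}}"
  proof (intro equalityI subsetI)
    fix x assume x: "x \<in> interval P le ?z v"
    then have "x \<in> interval P le ?z \<sigma>"
      using v(1) \<sigma> transp_onD[OF trans, of x v \<sigma>] by (auto simp: interval_def)
    then show "x \<in> {x \<in> interval P le ?z \<sigma>. f x \<subseteq> {0}}"
      using x v mono[of x v] by (auto simp: interval_def)
  next
    fix x assume x: "x \<in> {x \<in> interval P le ?z \<sigma>. f x \<subseteq> {0}}"
    then have "le x v" using v mono[of x v] by auto
    then show "x \<in> interval P le ?z v" using x by (auto simp: interval_def)
  qed
  have "bij_betw f (interval P le ?z v) (Pow {0})"
    unfolding bij_betw_def
  proof
    show "inj_on f (interval P le ?z v)"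
      unfolding sub using bij_betw_imp_inj_on[OF f] by (rule inj_on_subset) auto
    show "f ` interval P le ?z v = Pow {0}"
      unfolding sub
    proof (intro equalityI subsetI)
      fix S :: "nat set" assume "S \<in> Pow {0}"
      moreover from this \<open>0 < n\<close> have "S \<in> Pow {..<n}" by auto
      ultimately show "S \<in> f ` {x \<in> interval P le ?z \<sigma>. f x \<subseteq> {0}}"
        unfolding bij_betw_imp_surj_on[OF f, symmetric] by auto
    qed auto
  qed
  then have "boolean_of_rank (interval P le ?z v) le (card {0::nat})"
    by (rule boolean_of_rank_PowI[rotated]) (use sub mono in auto)
  then have "rank P le v = 1" by (simp add: rank_eqI)
  then show ?thesis using v(1) by (auto simp: vertices_of_def interval_def)
qed

text \<open>
  Maximality in the finite set of elements above \<open>\<sigma>\<close> is obtained by maximizing the number of elements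
  below, which grows strictly along the order.
\<close>

lemma facet_above:
  assumes "finite P" "reflp_on P le" "transp_on P le" "antisymp_on P le" "\<sigma> \<in> P"
  shows "\<exists>F\<in>facets P le. le \<sigma> F"
proof -
  let ?S = "{\<tau> \<in> P. le \<sigma> \<tau>}"
  let ?d = "\<lambda>\<tau>. card {\<rho> \<in> P. le \<rho> \<tau>}"
  have "finite ?S" "?S \<noteq> {}" using assms by (auto dest: reflp_onD)
  then have "Max (?d ` ?S) \<in> ?d ` ?S" by (intro Max_in) auto
  then obtain F where F: "F \<in> ?S" and max: "Max (?d ` ?S) = ?d F" by blast
  have "\<tau> = F" if "\<tau> \<in> P" "le F \<tau>" for \<tau>
  proof (rule ccontr)
    assume "\<tau> \<noteq> F"
    then have "\<not> le \<tau> F" using that F antisymp_onD[OF assms(4)] by blast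
    have "{\<rho> \<in> P. le \<rho> F} \<subset> {\<rho> \<in> P. le \<rho> \<tau>}"
      using that F \<open>\<not> le \<tau> F\<close> transp_onD[OF assms(3)] reflp_onD[OF assms(2)] by blast
    then have "?d F < ?d \<tau>" using assms(1) by (simp add: psubset_card_mono)
    have "\<tau> \<in> ?S" using that F transp_onD[OF assms(3)] assms(5) by blast
    have "?d \<tau> \<le> ?d F"
      using \<open>finite ?S\<close> \<open>\<tau> \<in> ?S\<close> unfolding max[symmetric] by (intro Max_ge) auto
    with \<open>?d F < ?d \<tau>\<close> show False by simp
  qed
  then show ?thesis using F by (auto simp: facets_def)
qed

lemma connected_closed_simplex: "Topological_Spaces.connected (closed_simplex P le \<sigma>)"
proof (rule path_connected_imp_connected, unfold path_connected_def, intro ballI)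
  fix x y assume x: "x \<in> closed_simplex P le \<sigma>" and y: "y \<in> closed_simplex P le \<sigma>"
  let ?g = "\<lambda>t v. (1 - t) * x v + t * y v"
  have "path ?g"
    unfolding path_def by (intro continuous_on_coordinatewise_then_product continuous_intros)
  moreover have "path_image ?g \<subseteq> closed_simplex P le \<sigma>"
    unfolding path_image_def using x y
    by (auto simp: closed_simplex_def sum.distrib simp flip: sum_distrib_left)
  moreover have "pathstart ?g = x" "pathfinish ?g = y"
    by (auto simp: pathstart_def pathfinish_def)
  ultimately show "\<exists>g. path g \<and> path_image g \<subseteq> closed_simplex P le \<sigma> \<and> pathstart g = x \<and> pathfinish g = y"
    by blast
qed

definition closed_cell :: "'a set \<Rightarrow> ('a \<Rightarrow> 'a \<Rightarrow> bool) \<Rightarrow> 'a \<Rightarrow> ('a \<times> ('a \<Rightarrow> real)) set set" where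
  "closed_cell P le \<sigma> = (\<lambda>p. gluing P le `` {p}) ` ({\<sigma>} \<times> closed_simplex P le \<sigma>)"

lemma topspace_CW_complex_of: "topspace (CW_complex_of P le) = (\<Union>\<sigma>\<in>P. closed_cell P le \<sigma>)"
  unfolding CW_complex_of_def topspace_quotient_topology simplex_sum_def closed_cell_def by auto

lemma connectedin_closed_cell:
  assumes "\<sigma> \<in> P"
  shows "connectedin (CW_complex_of P le) (closed_cell P le \<sigma>)"
proof -
  have "connectedin (top_of_set (closed_simplex P le \<sigma>)) (closed_simplex P le \<sigma>)"
    by (simp add: connectedin_subtopology connected_closed_simplex)
  then have "connectedin (simplex_sum P le) (Pair \<sigma> ` closed_simplex P le \<sigma>)"
    unfolding simplex_sum_def
    using continuous_map_component_injection[OF assms, of "\<lambda>\<sigma>. top_of_set (closed_simplex P le \<sigma>)"]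
    by (rule connectedin_continuous_map_image[rotated])
  moreover have "Pair \<sigma> ` closed_simplex P le \<sigma> = {\<sigma>} \<times> closed_simplex P le \<sigma>" by auto
  ultimately show ?thesis
    unfolding closed_cell_def CW_complex_of_def
    using connectedin_continuous_map_image[OF quotient_imp_continuous_map[OF quotient_map_quotient_topology]]
    by fastforce
qed

lemma gluing_iff:
  "((\<sigma>, x), (\<sigma>', x')) \<in> gluing P le \<longleftrightarrow>
     \<sigma> \<in> P \<and> \<sigma>' \<in> P \<and> x \<in> closed_simplex P le \<sigma> \<and> x \<in> closed_simplex P le \<sigma>' \<and> x' = x \<and>
     (\<exists>\<tau>\<in>P. le \<tau> \<sigma> \<and> le \<tau> \<sigma>' \<and> x \<in> closed_simplex P le \<tau>)"
  by (auto simp: gluing_def simplex_sum_def)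

text \<open>
  The barycentric coordinate vector \<open>e\<close> of the vertex \<open>v\<close> lies in the simplex of \<open>\<rho>\<close> exactly when
  \<open>v\<close> is below \<open>\<rho>\<close>, and then it already lies in the simplex of the common face \<open>v\<close>. So all copies
  of \<open>e\<close> are glued to one another and form a single class, which lies in every cell above \<open>v\<close>.
\<close>

lemma cells_meet_at_vertex:
  assumes "finite P" "reflp_on P le"
    and "\<sigma> \<in> P" "\<tau> \<in> P" "v \<in> vertices_of P le \<sigma>" "v \<in> vertices_of P le \<tau>"
  shows "closed_cell P le \<sigma> \<inter> closed_cell P le \<tau> \<noteq> {}"
proof -
  define e where "e = (\<lambda>w. if w = v then 1 else (0::real))"
  have v: "v \<in> P" "rank P le v = 1" using assms by (auto simp: vertices_of_def)
  have fin: "finite (vertices_of P le \<rho>)" for \<rho>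
    using assms(1) by (simp add: vertices_of_def)
  have e: "e \<in> closed_simplex P le \<rho> \<longleftrightarrow> le v \<rho>" if "\<rho> \<in> P" for \<rho>
  proof
    assume "e \<in> closed_simplex P le \<rho>"
    then have "v \<notin> vertices_of P le \<rho> \<longrightarrow> e v = 0" by (simp add: closed_simplex_def)
    then show "le v \<rho>" by (auto simp: e_def vertices_of_def split: if_splits)
  next
    assume "le v \<rho>"
    then have "v \<in> vertices_of P le \<rho>" using v by (simp add: vertices_of_def)
    then show "e \<in> closed_simplex P le \<rho>" using fin[of \<rho>]
      by (auto simp: closed_simplex_def e_def)
  qed
  have glued: "((\<rho>, e), (\<rho>', x)) \<in> gluing P le \<longleftrightarrow> \<rho>' \<in> P \<and> le v \<rho>' \<and> x = e"
    if "\<rho> \<in> P" "le v \<rho>" for \<rho> \<rho>' x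
  proof
    assume "((\<rho>, e), (\<rho>', x)) \<in> gluing P le"
    then show "\<rho>' \<in> P \<and> le v \<rho>' \<and> x = e" unfolding gluing_iff using e by blast
  next
    assume "\<rho>' \<in> P \<and> le v \<rho>' \<and> x = e"
    then show "((\<rho>, e), (\<rho>', x)) \<in> gluing P le"
      unfolding gluing_iff using that e v(1) reflp_onD[OF assms(2) v(1)] by blast
  qed
  moreover have "le v \<sigma>" "le v \<tau>" using assms by (auto simp: vertices_of_def)
  ultimately have "gluing P le `` {(\<sigma>, e)} = gluing P le `` {(\<tau>, e)}"
    using assms(3,4) by (auto simp only: Image_singleton_iff glued)
  moreover have "gluing P le `` {(\<sigma>, e)} \<in> closed_cell P le \<sigma>" "gluing P le `` {(\<tau>, e)} \<in> closed_cell P le \<tau>"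
    using e assms \<open>le v \<sigma>\<close> \<open>le v \<tau>\<close> by (auto simp: closed_cell_def)
  ultimately show ?thesis by auto
qed

text \<open>
  Each cell is connected. The rank hypothesis makes ridges have positive rank, so the cells of
  adjacent facets meet at a vertex of a common ridge; a nonempty cell likewise meets the cell of any
  facet above it. In rank 1 the conclusion fails for two points with common ridge the least element.
\<close>

lemma connected_poset_if_dual_graph_connected:
  assumes P: "simplicial_poset P le" and r: "poset_rank P le \<ge> 2"
    and dual: "Digraph_Component.connected (with_proj (dual_graph P le))"
  shows "connected_poset P le"
proof -
  let ?X = "CW_complex_of P le" and ?D = "mk_symmetric (with_proj (dual_graph P le))"
  have P': "finite P" "reflp_on P le" "transp_on P le" "antisymp_on P le"
    using P by (auto simp: simplicial_poset_def)
  have verts: "pverts ?D = facets P le" by (simp add: dual_graph_def)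
  have facet_in: "F \<in> P" if "F \<in> facets P le" for F using that by (simp add: facets_def)
  have cell: "connectedin ?X (closed_cell P le F)" if "F \<in> facets P le" for F
    using that by (intro connectedin_closed_cell facet_in)
  have adjacent: "F \<in> facets P le \<and> F' \<in> facets P le \<and> closed_cell P le F \<inter> closed_cell P le F' \<noteq> {}"
    if "(F, F') \<in> parcs ?D" for F F'
  proof -
    have F: "F \<in> facets P le" "F' \<in> facets P le"
      using that by (auto simp: parcs_mk_symmetric dual_graph_def)
    from that obtain \<rho> where \<rho>: "\<rho> \<in> ridges P le" "covered_by P le \<rho> F" "covered_by P le \<rho> F'"
      unfolding parcs_mk_symmetric dual_graph_def by auto
    have "rank P le \<rho> > 0" "\<rho> \<in> P" using \<rho>(1) r by (auto simp: ridges_def)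
    then obtain v where v: "v \<in> vertices_of P le \<rho>"
      using vertex_below_of_rank_pos[OF P] by blast
    then have "v \<in> vertices_of P le F" "v \<in> vertices_of P le F'"
      using \<rho> transp_onD[OF P'(3)] by (auto simp: vertices_of_def covered_by_def)
    then show ?thesis
      using cells_meet_at_vertex[OF P'(1,2)] F facet_in by blast
  qed
  have chain: "\<exists>S. connectedin ?X S \<and> closed_cell P le F \<union> closed_cell P le F' \<subseteq> S"
    if FF': "F \<in> facets P le" "F' \<in> facets P le" for F F'
  proof -
    have "(F, F') \<in> rtrancl_on (facets P le) (parcs ?D)"
      using dual FF' unfolding Digraph_Component.connected_def strongly_connected_def reachable_def
        with_proj_simps verts by blast
    then show ?thesis
    proof (induct rule: rtrancl_on_induct)
      case base
      then show ?case using cell[OF FF'(1)] by blast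
    next
      case (step F1 F2)
      from step(5) obtain S where S: "connectedin ?X S" "closed_cell P le F \<union> closed_cell P le F1 \<subseteq> S" by blast
      from adjacent[OF step(2)] have F2: "F2 \<in> facets P le" "closed_cell P le F1 \<inter> closed_cell P le F2 \<noteq> {}" by simp_all
      have "S \<inter> closed_cell P le F2 \<noteq> {}" using S(2) F2(2) by blast
      then have "connectedin ?X (S \<union> closed_cell P le F2)" by (intro connectedin_Un S(1) cell F2(1))
      then show ?case using S(2) by blast
    qed
  qed
  have to_facet: "\<exists>F\<in>facets P le. \<exists>S. connectedin ?X S \<and> p \<in> S \<and> closed_cell P le F \<subseteq> S \<and> closed_cell P le F \<noteq> {}"
    if "p \<in> topspace ?X" for p
  proof -
    from that obtain \<sigma> where \<sigma>: "\<sigma> \<in> P" "p \<in> closed_cell P le \<sigma>" by (auto simp: topspace_CW_complex_of)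
    then have "closed_simplex P le \<sigma> \<noteq> {}" by (auto simp: closed_cell_def)
    then have "vertices_of P le \<sigma> \<noteq> {}" by (auto simp: closed_simplex_def)
    then obtain v where v: "v \<in> vertices_of P le \<sigma>" by blast
    obtain F where F: "F \<in> facets P le" "le \<sigma> F" using facet_above[OF P' \<sigma>(1)] by blast
    have "v \<in> vertices_of P le F"
      using v F \<sigma> facet_in transp_onD[OF P'(3)] by (auto simp: vertices_of_def)
    then have meet: "closed_cell P le \<sigma> \<inter> closed_cell P le F \<noteq> {}"
      using cells_meet_at_vertex[OF P'(1,2) \<sigma>(1) facet_in[OF F(1)] v] by blast
    then have "connectedin ?X (closed_cell P le \<sigma> \<union> closed_cell P le F)"
      by (intro connectedin_Un connectedin_closed_cell \<sigma>(1) facet_in F(1))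
    moreover have "closed_cell P le F \<noteq> {}" using meet by blast
    ultimately show ?thesis
      using F(1) \<sigma>(2) by (intro bexI[of _ F] exI[of _ "closed_cell P le \<sigma> \<union> closed_cell P le F"]) auto
  qed
  have "\<exists>S. connectedin ?X S \<and> p \<in> S \<and> q \<in> S" if pq: "p \<in> topspace ?X" "q \<in> topspace ?X" for p q
  proof -
    obtain F S where S: "F \<in> facets P le" "connectedin ?X S" "p \<in> S" "closed_cell P le F \<subseteq> S" "closed_cell P le F \<noteq> {}"
      using to_facet[OF pq(1)] by blast
    obtain F' S' where S': "F' \<in> facets P le" "connectedin ?X S'" "q \<in> S'" "closed_cell P le F' \<subseteq> S'" "closed_cell P le F' \<noteq> {}"
      using to_facet[OF pq(2)] by blast
    obtain S'' where S'': "connectedin ?X S''" "closed_cell P le F \<union> closed_cell P le F' \<subseteq> S''"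
      using chain[OF S(1) S'(1)] by blast
    have "S \<inter> S'' \<noteq> {}" using S(4,5) S''(2) by blast
    then have "connectedin ?X (S \<union> S'')" by (intro connectedin_Un S(2) S''(1))
    moreover have "(S \<union> S'') \<inter> S' \<noteq> {}" using S'(4,5) S''(2) by blast
    ultimately have "connectedin ?X (S \<union> S'' \<union> S')" by (intro connectedin_Un[OF _ S'(2)])
    then show ?thesis using S(3) S'(3) by blast
  qed
  then show ?thesis
    unfolding connected_poset_def connected_space_subconnected by blast
qed


section \<open>Connected components of induced subgraphs\<close>

lemma (in wf_digraph) connected_imp_reachable:
  assumes "symmetric G" "subgraph C G" "Digraph_Component.connected C" "x \<in> verts C" "y \<in> verts C"
  shows "x \<rightarrow>\<^sup>* y"
proof -
  have "x \<rightarrow>\<^sup>*\<^bsub>with_proj (mk_symmetric C)\<^esub> y"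
    using assms by (auto simp: Digraph_Component.connected_def strongly_connected_def)
  then have "x \<rightarrow>\<^sup>*\<^bsub>with_proj (mk_symmetric G)\<^esub> y"
    using subgraph_mk_symmetric[OF assms(2)] by (rule pre_digraph.reachable_mono)
  then show ?thesis using reachable_mk_symmetric_eq[OF assms(1)] by simp
qed

lemma (in sym_digraph) connected_reachable_set:
  assumes "x \<in> verts G"
  shows "Digraph_Component.connected (G \<restriction> {y. x \<rightarrow>\<^sup>* y})"
proof -
  let ?H = "G \<restriction> {y. x \<rightarrow>\<^sup>* y}"
  have "induced_subgraph ?H G" using reachable_in_verts(2) by (intro induced_induce) blast
  then interpret H: sym_digraph ?H by (rule induced_graph_imp_graph)
  have "u \<rightarrow>\<^sup>*\<^bsub>?H\<^esub> v" if "x \<rightarrow>\<^sup>* u" "x \<rightarrow>\<^sup>* v" for u v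
    using induce_reachable_preserves_paths[OF that(1)] induce_reachable_preserves_paths[OF that(2)]
    by (meson H.symmetric_reachable' H.reachable_trans)
  then show ?thesis
    using assms H.reachable_mk_symmetricI
    by (auto simp: Digraph_Component.connected_def strongly_connected_def)
qed

text \<open>
  A maximal connected subgraph is the subgraph induced on the set of vertices reachable from any of its
  vertices: the latter is connected and contains every connected subgraph through that vertex.
\<close>

lemma (in sym_digraph) connected_component_iff:
  "(\<exists>C. connected_component G C \<and> verts C = W) \<longleftrightarrow> (\<exists>x\<in>verts G. W = {y. x \<rightarrow>\<^sup>* y})"
proof
  assume "\<exists>C. connected_component G C \<and> verts C = W"
  then obtain C where C: "subgraph C G" "Digraph_Component.connected C" "verts C = W"
    and max: "\<And>H. subgraph C H \<Longrightarrow> subgraph H G \<Longrightarrow> Digraph_Component.connected H \<Longrightarrow> H = C"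
    unfolding connected_component_def max_subgraph_def by blast
  from C(2) obtain x where x: "x \<in> verts C"
    by (auto simp: Digraph_Component.connected_def strongly_connected_def)
  let ?H = "G \<restriction> {y. x \<rightarrow>\<^sup>* y}"
  have "x \<in> verts G" using x C(1) by auto
  have HG: "subgraph ?H G" using reachable_in_verts(2) by (intro subgraph_induce_subgraphI) blast
  have "verts C \<subseteq> {y. x \<rightarrow>\<^sup>* y}"
    using connected_imp_reachable[OF sym_arcs C(1,2) x] by blast
  then have "subgraph C ?H"
    using C(1) by (auto simp: subgraph_def compatible_def wf_digraph.tail_in_verts wf_digraph.head_in_verts
        subset_iff wellformed_induce_subgraph)
  then have "?H = C" using max HG connected_reachable_set[OF \<open>x \<in> verts G\<close>] by blast
  then have "verts C = {y. x \<rightarrow>\<^sup>* y}" by (metis induce_subgraph_verts)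
  with C(3) \<open>x \<in> verts G\<close> show "\<exists>x\<in>verts G. W = {y. x \<rightarrow>\<^sup>* y}" by blast
next
  assume "\<exists>x\<in>verts G. W = {y. x \<rightarrow>\<^sup>* y}"
  then obtain x where x: "x \<in> verts G" "W = {y. x \<rightarrow>\<^sup>* y}" by blast
  have HG: "subgraph (G \<restriction> W) G"
    unfolding x(2) using reachable_in_verts(2) by (intro subgraph_induce_subgraphI) blast
  have "H = G \<restriction> W" if H: "subgraph (G \<restriction> W) H" "subgraph H G" "Digraph_Component.connected H" for H
  proof -
    have "x \<in> W" using x by simp
    then have "x \<in> verts H" using subgraph_imp_subverts[OF H(1)] by auto
    then have "verts H = W"
      using connected_imp_reachable[OF sym_arcs H(2,3)] subgraph_imp_subverts[OF H(1)] x(2) by auto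
    moreover have "arcs H = arcs (G \<restriction> W)"
      using H(1,2) \<open>verts H = W\<close>
      by (auto simp: subgraph_def compatible_def dest: wf_digraph.tail_in_verts wf_digraph.head_in_verts)
    ultimately show ?thesis
      using H(2) by (intro pre_digraph.equality) (auto simp: subgraph_def compatible_def)
  qed
  then have "connected_component G (G \<restriction> W)"
    unfolding connected_component_def max_subgraph_def
    using HG connected_reachable_set[OF x(1)] x(2) by auto
  then show "\<exists>C. connected_component G C \<and> verts C = W" by (metis induce_subgraph_verts)
qed

definition component_of :: "'a pair_pre_digraph \<Rightarrow> 'a set \<Rightarrow> 'a \<Rightarrow> 'a set" where
  "component_of G U x = {y. x \<rightarrow>\<^sup>*\<^bsub>with_proj G \<restriction> U\<^esub> y}"

context pair_graph
begin

lemma sym_digraph_induce: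
  assumes "U \<subseteq> pverts G" shows "sym_digraph (with_proj G \<restriction> U)"
  using induced_graph_imp_graph[OF induced_induce[OF assms]] .

lemma component_of_subset: "component_of G U x \<subseteq> U"
  by (auto simp: component_of_def elim: reachable_in_vertsE)

lemma component_of_self: "x \<in> U \<Longrightarrow> x \<in> component_of G U x"
  using wf_digraph.reachable_refl[OF wellformed_induce_subgraph] by (simp add: component_of_def)

lemma component_of_eq:
  assumes "U \<subseteq> pverts G" "y \<in> component_of G U x"
  shows "component_of G U y = component_of G U x"
proof -
  interpret H: sym_digraph "with_proj G \<restriction> U" using assms(1) by (rule sym_digraph_induce)
  show ?thesis
    using assms(2) H.symmetric_reachable' H.reachable_trans
    unfolding component_of_def by blast
qed

lemma component_of_mono: "U \<subseteq> U' \<Longrightarrow> component_of G U x \<subseteq> component_of G U' x"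
  unfolding component_of_def using reachable_induce_ss by blast

lemma component_of_adjacent:
  assumes "(x, y) \<in> parcs G" "x \<in> U" "y \<in> U"
  shows "y \<in> component_of G U x"
proof -
  have "x \<rightarrow>\<^bsub>with_proj G \<restriction> U\<^esub> y" using assms by (force simp: arcs_ends_conv)
  then show ?thesis
    unfolding component_of_def using wf_digraph.reachable_adjI[OF wellformed_induce_subgraph] by simp
qed

text \<open>
  A walk inside \<open>{x, y}\<close> from \<open>x\<close> to \<open>y\<close> can leave \<open>x\<close> only along the edge between them.
\<close>

lemma component_of_pair:
  assumes "y \<in> component_of G {x, y} x" "x \<noteq> y"
  shows "(x, y) \<in> parcs G"
proof (rule ccontr)
  assume no: "(x, y) \<notin> parcs G"
  have "x \<rightarrow>\<^sup>*\<^bsub>with_proj G \<restriction> {x, y}\<^esub> y" using assms(1) by (simp add: component_of_def)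
  then have "y = x"
    unfolding reachable_def
    by (induct rule: rtrancl_on_induct) (use no in \<open>auto simp: arcs_ends_conv\<close>)
  with assms(2) show False by simp
qed

text \<open>
  A walk in \<open>U\<close> that starts in a component stays in it. This makes the dual graph of a link connected.
\<close>

lemma reachable_within_component:
  assumes "U \<subseteq> pverts G" "W = component_of G U x" "u \<in> W" "v \<in> W"
  shows "u \<rightarrow>\<^sup>*\<^bsub>with_proj G \<restriction> W\<^esub> v"
proof -
  interpret H: sym_digraph "with_proj G \<restriction> U" using assms(1) by (rule sym_digraph_induce)
  have W: "W = {y. u \<rightarrow>\<^sup>*\<^bsub>with_proj G \<restriction> U\<^esub> y}"
    using component_of_eq[OF assms(1), of u x] assms(2,3) by (simp add: component_of_def)
  have "W \<subseteq> U" using assms(2) component_of_subset by simp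
  then have "(with_proj G \<restriction> U) \<restriction> W = with_proj G \<restriction> W" by (auto simp: induce_subgraph_def)
  moreover have "u \<rightarrow>\<^sup>*\<^bsub>(with_proj G \<restriction> U) \<restriction> W\<^esub> v"
    using H.induce_reachable_preserves_paths[of u v] assms(4) W by simp
  ultimately show ?thesis by simp
qed

lemma graph_poset_iff:
  "(W, T) \<in> graph_poset G \<longleftrightarrow>
     T \<subset> pverts G \<and> (\<exists>x\<in>pverts G - T. W = component_of G (pverts G - T) x)"
proof -
  interpret H: sym_digraph "with_proj G \<restriction> (pverts G - T)" by (rule sym_digraph_induce) auto
  show ?thesis
    using H.connected_component_iff[of W] by (auto simp: graph_poset_def component_of_def)
qed

lemma graph_posetD:
  assumes "(W, T) \<in> graph_poset G"
  shows "T \<subset> pverts G" "W \<noteq> {}" "W \<subseteq> pverts G - T"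
    "\<And>x. x \<in> W \<Longrightarrow> W = component_of G (pverts G - T) x"
proof -
  from assms obtain x where x: "T \<subset> pverts G" "x \<in> pverts G - T" "W = component_of G (pverts G - T) x"
    by (auto simp: graph_poset_iff)
  then show "T \<subset> pverts G" "W \<noteq> {}" "W \<subseteq> pverts G - T"
    using component_of_self[OF x(2)] component_of_subset by auto
  show "W = component_of G (pverts G - T) y" if "y \<in> W" for y
    using component_of_eq[of "pverts G - T" y x] x that by auto
qed

text \<open>
  Components for a larger deleted set are contained in or disjoint from components for a smaller one,
  so that only the second coordinates have to be compared.
\<close>

lemma graph_poset_le_if_meet:
  assumes "(W, T) \<in> graph_poset G" "(W', T') \<in> graph_poset G" "T \<subseteq> T'" "W \<inter> W' \<noteq> {}"
  shows "graph_poset_le (W, T) (W', T')"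
proof -
  obtain x where x: "x \<in> W" "x \<in> W'" using assms(4) by blast
  have "W' \<subseteq> W"
    using graph_posetD(4)[OF assms(1) x(1)] graph_posetD(4)[OF assms(2) x(2)] assms(3)
      component_of_mono[of "pverts G - T'" "pverts G - T" x] by auto
  then show ?thesis using assms(3) by (simp add: graph_poset_le_def)
qed

lemma vertex_facet_in_graph_poset:
  assumes "i \<in> pverts G"
  shows "vertex_facet G i \<in> graph_poset G"
proof -
  have "pverts G - (pverts G - {i}) = {i}" using assms by auto
  then show ?thesis
    using assms component_of_self[of i "{i}"] component_of_subset[of "{i}" i]
    by (auto simp: vertex_facet_def graph_poset_iff)
qed

subsection \<open>The order on the pairs \<open>(W, T)\<close>\<close>

abbreviation lk :: "'a set \<times> 'a set \<Rightarrow> ('a set \<times> 'a set) set" where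
  "lk \<equiv> link (graph_poset G) graph_poset_le"

lemma graph_poset_eqI:
  assumes "(W, T) \<in> graph_poset G" "(W', T) \<in> graph_poset G" "W \<inter> W' \<noteq> {}"
  shows "W = W'"
  using graph_posetD(4)[OF assms(1)] graph_posetD(4)[OF assms(2)] assms(3) by blast

text \<open>
  Restoring deleted vertices can only enlarge a component; with uniqueness (\<open>graph_poset_eqI\<close>) this
  makes the second coordinate a faithful parameter for the elements below \<open>(W, T)\<close>.
\<close>

lemma graph_poset_coarsen:
  assumes "(W, T) \<in> graph_poset G" "S \<subseteq> T"
  shows "\<exists>U. (U, S) \<in> graph_poset G \<and> W \<subseteq> U"
proof -
  obtain x where x: "x \<in> W" using graph_posetD(2)[OF assms(1)] by blast
  let ?U = "component_of G (pverts G - S) x"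
  have "W \<subseteq> ?U"
    using graph_posetD(4)[OF assms(1) x] assms(2) component_of_mono[of "pverts G - T" "pverts G - S" x] by auto
  moreover have "(?U, S) \<in> graph_poset G"
    using graph_posetD(1,3)[OF assms(1)] x assms(2) by (auto simp: graph_poset_iff)
  ultimately show ?thesis by blast
qed

lemma finite_graph_poset: "finite (graph_poset G)"
proof (rule finite_subset)
  show "graph_poset G \<subseteq> Pow (pverts G) \<times> Pow (pverts G)"
    using graph_posetD(1,3) by fastforce
qed (simp add: pair_finite_verts)

lemma graph_poset_order:
  "reflp_on (graph_poset G) graph_poset_le" "transp_on (graph_poset G) graph_poset_le"
  "antisymp_on (graph_poset G) graph_poset_le"
  by (auto simp: graph_poset_le_def reflp_on_def transp_on_def antisymp_on_def)

lemma link_iff: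
  "(W', T') \<in> lk (W, T) \<longleftrightarrow> (W', T') \<in> graph_poset G \<and> W' \<subseteq> W \<and> T \<subseteq> T'"
  by (auto simp: link_def graph_poset_le_def)

lemma link_order:
  "finite (lk \<sigma>)" "reflp_on (lk \<sigma>) graph_poset_le" "transp_on (lk \<sigma>) graph_poset_le"
  "antisymp_on (lk \<sigma>) graph_poset_le"
proof -
  have "lk \<sigma> \<subseteq> graph_poset G" by (auto simp: link_def)
  then show "finite (lk \<sigma>)" "reflp_on (lk \<sigma>) graph_poset_le" "transp_on (lk \<sigma>) graph_poset_le"
    "antisymp_on (lk \<sigma>) graph_poset_le"
    using finite_graph_poset graph_poset_order
    by (auto intro: finite_subset reflp_on_subset transp_on_subset antisymp_on_subset)
qed

lemma link_link:
  assumes "\<tau> \<in> lk \<sigma>"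
  shows "link (lk \<sigma>) graph_poset_le \<tau> = lk \<tau>"
  using assms by (auto simp: link_def graph_poset_le_def)

lemma vertex_facet_in_link:
  assumes "(W, T) \<in> graph_poset G" "i \<in> W"
  shows "vertex_facet G i \<in> lk (W, T)"
proof -
  have "i \<in> pverts G" "T \<subseteq> pverts G - {i}" using graph_posetD(1,3)[OF assms(1)] assms(2) by auto
  then show ?thesis
    using assms(2) vertex_facet_in_graph_poset[of i] by (auto simp: vertex_facet_def link_iff)
qed

lemma graph_poset_cofacet:
  assumes "(W, pverts G - {i}) \<in> graph_poset G"
  shows "(W, pverts G - {i}) = vertex_facet G i"
  using graph_posetD(2,3)[OF assms] by (auto simp: vertex_facet_def)

lemma card_T_less:
  assumes "(W, T) \<in> graph_poset G" shows "card T < card (pverts G)"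
  using psubset_card_mono[OF pair_finite_verts graph_posetD(1)[OF assms]] .

lemma ridge_complement:
  assumes "(W, T) \<in> graph_poset G" "card T + 2 = card (pverts G)" "i \<in> W"
  obtains j where "j \<noteq> i" "pverts G - T = {i, j}"
proof -
  have T: "T \<subseteq> pverts G" "i \<in> pverts G - T" using graph_posetD(1,3)[OF assms(1)] assms(3) by auto
  have "card (pverts G - T) = 2"
    using assms(2) T(1) pair_finite_verts by (simp add: card_Diff_subset finite_subset)
  then obtain a b where "pverts G - T = {a, b}" "a \<noteq> b" by (auto simp: card_2_iff)
  then show ?thesis using T(2) that[of a] that[of b] by (auto simp: insert_commute)
qed

lemma inj_vertex_facet: "inj (vertex_facet G)"
  by (auto simp: inj_def vertex_facet_def)

subsection \<open>The link of an element\<close>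

context
  fixes W0 T0
  assumes base: "(W0, T0) \<in> graph_poset G"
begin

lemma base_is_least: "is_least (lk (W0, T0)) graph_poset_le (W0, T0)"
  using base by (auto simp: is_least_def link_def graph_poset_le_def)

lemma least_elt_link: "least_elt (lk (W0, T0)) graph_poset_le = (W0, T0)"
  using link_order(4) base_is_least by (rule least_elt_eqI)

text \<open>
  The isomorphism sends \<open>(U, S)\<close> to \<open>S - T0\<close>. All components occurring in the interval contain the
  nonempty set \<open>W\<close>, hence meet one another; this is why inclusion of second coordinates decides the
  order.
\<close>

lemma interval_boolean:
  assumes "(W, T) \<in> lk (W0, T0)"
  shows "boolean_of_rank (interval (lk (W0, T0)) graph_poset_le (W0, T0) (W, T)) graph_poset_le (card (T - T0))"
proof (rule boolean_of_rank_PowI)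
  let ?B = "interval (lk (W0, T0)) graph_poset_le (W0, T0) (W, T)"
  let ?f = "\<lambda>\<tau>::'a set \<times> 'a set. snd \<tau> - T0"
  have WT: "(W, T) \<in> graph_poset G" "W \<subseteq> W0" "T0 \<subseteq> T" using assms by (auto simp: link_iff)
  have B: "(U, S) \<in> ?B \<longleftrightarrow> (U, S) \<in> graph_poset G \<and> W \<subseteq> U \<and> U \<subseteq> W0 \<and> T0 \<subseteq> S \<and> S \<subseteq> T" for U S
    unfolding interval_def mem_Collect_eq link_iff by (auto simp: graph_poset_le_def)
  have W: "W \<noteq> {}" using graph_posetD(2)[OF WT(1)] .
  show "finite (T - T0)"
    using graph_posetD(1)[OF WT(1)] pair_finite_verts by (meson finite_Diff finite_subset psubsetE)
  show le: "graph_poset_le \<rho> \<tau> \<longleftrightarrow> ?f \<rho> \<subseteq> ?f \<tau>" if "\<rho> \<in> ?B" "\<tau> \<in> ?B" for \<rho> \<tau>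
  proof -
    obtain U S U' S' where eq: "\<rho> = (U, S)" "\<tau> = (U', S')" by (metis surj_pair)
    have U: "(U, S) \<in> graph_poset G" "W \<subseteq> U" "T0 \<subseteq> S" and U': "(U', S') \<in> graph_poset G" "W \<subseteq> U'" "T0 \<subseteq> S'"
      using that B unfolding eq by blast+
    have "?f \<rho> \<subseteq> ?f \<tau> \<longleftrightarrow> S \<subseteq> S'" using U(3) U'(3) unfolding eq by auto
    moreover have "U \<inter> U' \<noteq> {}" using U(2) U'(2) W by blast
    ultimately show ?thesis
      using graph_poset_le_if_meet[OF U(1) U'(1)] unfolding eq by (auto simp: graph_poset_le_def)
  qed
  have inj: "inj_on ?f ?B"
  proof (rule inj_onI)
    fix \<rho> \<tau> assume *: "\<rho> \<in> ?B" "\<tau> \<in> ?B" "?f \<rho> = ?f \<tau>"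
    then have "graph_poset_le \<rho> \<tau>" "graph_poset_le \<tau> \<rho>" by (simp_all add: le)
    then show "\<rho> = \<tau>" by (cases \<rho>; cases \<tau>) (auto simp: graph_poset_le_def)
  qed
  have "A \<in> ?f ` ?B" if "A \<subseteq> T - T0" for A
  proof -
    have "T0 \<union> A \<subseteq> T" using that WT(3) by blast
    then obtain U where U: "(U, T0 \<union> A) \<in> graph_poset G" "W \<subseteq> U"
      using graph_poset_coarsen[OF WT(1)] by blast
    have "W0 \<inter> U \<noteq> {}" using U(2) WT(2) W by blast
    then have "U \<subseteq> W0"
      using graph_poset_le_if_meet[OF base U(1)] by (auto simp: graph_poset_le_def)
    then have "(U, T0 \<union> A) \<in> ?B" using U \<open>T0 \<union> A \<subseteq> T\<close> by (simp add: B)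
    moreover have "?f (U, T0 \<union> A) = A" using that by auto
    ultimately show ?thesis by (metis image_eqI)
  qed
  moreover have "?f \<tau> \<subseteq> T - T0" if "\<tau> \<in> ?B" for \<tau>
    using that by (cases \<tau>) (auto simp: B)
  ultimately show "bij_betw ?f ?B (Pow (T - T0))"
    unfolding bij_betw_def using inj by blast
qed

lemma rank_link: "(W, T) \<in> lk (W0, T0) \<Longrightarrow> rank (lk (W0, T0)) graph_poset_le (W, T) = card T - card T0"
proof -
  assume WT: "(W, T) \<in> lk (W0, T0)"
  have "rank (lk (W0, T0)) graph_poset_le (W, T) = card (T - T0)"
    by (rule rank_eqI) (simp add: least_elt_link interval_boolean[OF WT])
  moreover have "T0 \<subseteq> T" "T0 \<subseteq> pverts G"
    using WT graph_posetD(1)[OF base] by (auto simp: link_iff)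
  ultimately show ?thesis
    using pair_finite_verts by (simp add: card_Diff_subset finite_subset)
qed

lemma simplicial_poset_link: "simplicial_poset (lk (W0, T0)) graph_poset_le"
  unfolding simplicial_poset_def least_elt_link
  proof (intro conjI ballI link_order)
  show "\<exists>z. is_least (lk (W0, T0)) graph_poset_le z" using base_is_least by blast
  show "\<exists>n. boolean_of_rank (interval (lk (W0, T0)) graph_poset_le (W0, T0) \<sigma>) graph_poset_le n"
    if "\<sigma> \<in> lk (W0, T0)" for \<sigma>
    using interval_boolean that by (cases \<sigma>) blast
qed

lemma facets_link: "facets (lk (W0, T0)) graph_poset_le = vertex_facet G ` W0"
proof (intro equalityI subsetI)
  fix \<sigma> assume "\<sigma> \<in> facets (lk (W0, T0)) graph_poset_le"
  then have in_link: "\<sigma> \<in> lk (W0, T0)" and max: "\<And>\<tau>. \<tau> \<in> lk (W0, T0) \<Longrightarrow> graph_poset_le \<sigma> \<tau> \<Longrightarrow> \<tau> = \<sigma>"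
    by (auto simp: facets_def)
  obtain W T where \<sigma>: "\<sigma> = (W, T)" by (cases \<sigma>)
  have WT: "(W, T) \<in> graph_poset G" "W \<subseteq> W0" using in_link by (auto simp: \<sigma> link_iff)
  obtain i where i: "i \<in> W" using graph_posetD(2)[OF WT(1)] by blast
  have "vertex_facet G i \<in> lk (W, T)" using WT(1) i by (rule vertex_facet_in_link)
  moreover have "lk (W, T) \<subseteq> lk (W0, T0)" using in_link unfolding \<sigma> by (auto simp: link_def graph_poset_le_def)
  moreover have "graph_poset_le \<sigma> (vertex_facet G i)"
    using calculation(1) by (simp add: link_def \<sigma>)
  ultimately have "vertex_facet G i = \<sigma>" by (intro max) blast+
  then show "\<sigma> \<in> vertex_facet G ` W0" using i WT(2) by blast
next
  fix \<sigma> assume "\<sigma> \<in> vertex_facet G ` W0"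
  then obtain i where i: "i \<in> W0" "\<sigma> = vertex_facet G i" by blast
  have "\<tau> = \<sigma>" if "\<tau> \<in> lk (W0, T0)" "graph_poset_le \<sigma> \<tau>" for \<tau>
  proof -
    obtain W T where \<tau>: "\<tau> = (W, T)" by (cases \<tau>)
    have WT: "(W, T) \<in> graph_poset G" using that(1) by (simp add: \<tau> link_iff)
    have "pverts G - {i} \<subseteq> T" "W \<subseteq> {i}" using that(2) by (auto simp: i(2) \<tau> vertex_facet_def graph_poset_le_def)
    then show ?thesis using graph_posetD(1,2,3)[OF WT] by (auto simp: i(2) \<tau> vertex_facet_def)
  qed
  then show "\<sigma> \<in> facets (lk (W0, T0)) graph_poset_le"
    using vertex_facet_in_link[OF base i(1)] by (auto simp: facets_def i(2))
qed

lemma rank_vertex_facet: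
  assumes "i \<in> W0"
  shows "rank (lk (W0, T0)) graph_poset_le (vertex_facet G i) = card (pverts G) - 1 - card T0"
proof -
  have "i \<in> pverts G" using graph_posetD(3)[OF base] assms by auto
  then show ?thesis
    using rank_link vertex_facet_in_link[OF base assms] pair_finite_verts by (simp add: vertex_facet_def)
qed

lemma pure_link: "pure (lk (W0, T0)) graph_poset_le"
  unfolding pure_def facets_link by (auto simp: rank_vertex_facet)

lemma poset_rank_link: "poset_rank (lk (W0, T0)) graph_poset_le = card (pverts G) - 1 - card T0"
  unfolding poset_rank_def
proof (rule Max_eqI)
  show "finite (rank (lk (W0, T0)) graph_poset_le ` lk (W0, T0))" using link_order(1) by simp
  fix n assume "n \<in> rank (lk (W0, T0)) graph_poset_le ` lk (W0, T0)"
  then obtain W T where WT: "(W, T) \<in> lk (W0, T0)" "n = rank (lk (W0, T0)) graph_poset_le (W, T)" by auto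
  then have "n = card T - card T0" by (simp add: rank_link)
  moreover have "card T < card (pverts G)" using WT(1) by (intro card_T_less[of W]) (simp add: link_iff)
  ultimately show "n \<le> card (pverts G) - 1 - card T0" by linarith
next
  obtain i where "i \<in> W0" using graph_posetD(2)[OF base] by blast
  then show "card (pverts G) - 1 - card T0 \<in> rank (lk (W0, T0)) graph_poset_le ` lk (W0, T0)"
    using rank_vertex_facet[of i] vertex_facet_in_link[OF base] by (metis image_eqI)
qed

text \<open>
  The truncated differences in the ranks are harmless because \<open>T0 \<subseteq> T\<close> and \<open>T\<close> is a proper subset
  of the vertex set.
\<close>

lemma ridges_link:
  "(W, T) \<in> ridges (lk (W0, T0)) graph_poset_le \<longleftrightarrow> (W, T) \<in> lk (W0, T0) \<and> card T + 2 = card (pverts G)"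
proof -
  have "rank (lk (W0, T0)) graph_poset_le (W, T) + 1 = poset_rank (lk (W0, T0)) graph_poset_le \<longleftrightarrow>
      card T + 2 = card (pverts G)" if "(W, T) \<in> lk (W0, T0)"
  proof -
    have "T0 \<subseteq> T" "T \<subset> pverts G" using that graph_posetD(1) by (auto simp: link_iff)
    then have "card T0 \<le> card T" using pair_finite_verts by (meson card_mono finite_subset psubsetE)
    then show ?thesis using that by (simp add: rank_link poset_rank_link) linarith
  qed
  then show ?thesis by (auto simp: ridges_def)
qed

text \<open>
  Two vertices remain outside \<open>T\<close>, so a proper enlargement of \<open>T\<close> that is still a proper subset of the
  vertex set misses exactly one vertex \<open>i\<close>, and \<open>{i}\<close> is then the only component.
\<close>

lemma covers_ridge:
  assumes "(W, T) \<in> ridges (lk (W0, T0)) graph_poset_le"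
  shows "{\<tau> \<in> lk (W0, T0). covered_by (lk (W0, T0)) graph_poset_le (W, T) \<tau>} = vertex_facet G ` W"
proof -
  have WT: "(W, T) \<in> graph_poset G" "(W, T) \<in> lk (W0, T0)" "W \<subseteq> W0" "T0 \<subseteq> T"
    and card_T: "card T + 2 = card (pverts G)"
    using assms by (auto simp: ridges_link link_iff)
  show ?thesis
  proof (intro equalityI subsetI)
    fix \<tau> assume cov: "\<tau> \<in> {\<tau> \<in> lk (W0, T0). covered_by (lk (W0, T0)) graph_poset_le (W, T) \<tau>}"
    obtain W' T' where \<tau>: "\<tau> = (W', T')" by (cases \<tau>)
    have "(W', T') \<in> lk (W0, T0)" "graph_poset_le (W, T) (W', T')" and neq: "(W', T') \<noteq> (W, T)"
      using cov unfolding \<tau> covered_by_def by blast+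
    then have W'T': "(W', T') \<in> graph_poset G" "W' \<subseteq> W" "T \<subseteq> T'"
      unfolding link_iff by (simp_all add: graph_poset_le_def)
    obtain i where i: "i \<in> W'" using graph_posetD(2)[OF W'T'(1)] by blast
    then have "i \<in> W" using W'T'(2) by blast
    then obtain j where j: "j \<noteq> i" "pverts G - T = {i, j}"
      using ridge_complement[OF WT(1) card_T] by blast
    have "T' \<noteq> T" using neq graph_poset_eqI[of W' T W] W'T' WT(1) i by blast
    moreover have "i \<notin> T'" "T' \<subseteq> pverts G" using graph_posetD(1,3)[OF W'T'(1)] i by auto
    moreover obtain x where x: "x \<in> T'" "x \<notin> T" using W'T'(3) calculation(1) by blast
    moreover have "x = j" using \<open>i \<notin> T'\<close> \<open>T' \<subseteq> pverts G\<close> x j(2) by auto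
    moreover have "pverts G - {i, j} \<subseteq> T" using j(2) by blast
    ultimately have "T' = pverts G - {i}" using W'T'(3) by auto
    then have "\<tau> = vertex_facet G i" using graph_poset_cofacet[of W' i] W'T'(1) \<tau> by simp
    then show "\<tau> \<in> vertex_facet G ` W" using \<open>i \<in> W\<close> by blast
  next
    fix \<tau> assume "\<tau> \<in> vertex_facet G ` W"
    then obtain i where i: "i \<in> W" "\<tau> = vertex_facet G i" by blast
    then obtain j where j: "j \<noteq> i" "pverts G - T = {i, j}"
      using ridge_complement[OF WT(1) card_T] by blast
    have \<tau>: "\<tau> \<in> lk (W0, T0)" using vertex_facet_in_link[OF base, of i] i WT(3) by blast
    have le: "graph_poset_le (W, T) \<tau>"
      using vertex_facet_in_link[OF WT(1) i(1)] by (simp add: i(2) link_def)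
    have "(W, T) \<noteq> \<tau>" using j by (auto simp: i(2) vertex_facet_def)
    moreover have "\<rho> = (W, T) \<or> \<rho> = \<tau>"
      if "\<rho> \<in> lk (W0, T0)" "graph_poset_le (W, T) \<rho>" "graph_poset_le \<rho> \<tau>" for \<rho>
    proof -
      obtain U S where \<rho>: "\<rho> = (U, S)" by (cases \<rho>)
      have US: "(U, S) \<in> graph_poset G" "U \<subseteq> W" "T \<subseteq> S" "S \<subseteq> pverts G - {i}" "i \<in> U"
        using that unfolding \<rho> i(2) link_iff by (auto simp: graph_poset_le_def vertex_facet_def)
      then consider "S = T" | "S = pverts G - {i}" using j by blast
      then show ?thesis
      proof cases
        case 1
        then show ?thesis using graph_poset_eqI[of U T W] US WT(1) i(1) by (auto simp: \<rho>)
      next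
        case 2
        then show ?thesis using graph_poset_cofacet[of U i] US(1) by (simp add: \<rho> i(2))
      qed
    qed
    ultimately show "\<tau> \<in> {\<tau> \<in> lk (W0, T0). covered_by (lk (W0, T0)) graph_poset_le (W, T) \<tau>}"
      using \<tau> le WT(2) by (auto simp: covered_by_def)
  qed
qed

lemma edge_face:
  assumes "(i, j) \<in> parcs G" "i \<in> W0" "j \<in> W0"
  shows "({i, j}, pverts G - {i, j}) \<in> ridges (lk (W0, T0)) graph_poset_le"
proof -
  have ij: "i \<in> pverts G - T0" "j \<in> pverts G - T0" using graph_posetD(3)[OF base] assms by auto
  have "i \<noteq> j" using pair_no_loops[OF assms(1)] by simp
  have compl: "pverts G - (pverts G - {i, j}) = {i, j}" using ij by auto
  have "component_of G {i, j} i = {i, j}"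
    using component_of_self[of i "{i, j}"] component_of_adjacent[OF assms(1), of "{i, j}"]
      component_of_subset[of "{i, j}" i] by auto
  then have "({i, j}, pverts G - {i, j}) \<in> graph_poset G"
    using ij by (auto simp: graph_poset_iff compl)
  moreover have "T0 \<subseteq> pverts G - {i, j}" using graph_posetD(1)[OF base] ij by auto
  moreover have "card (pverts G - {i, j}) + 2 = card (pverts G)"
  proof -
    have "{i, j} \<subseteq> pverts G" using ij by auto
    then have "card {i, j} \<le> card (pverts G)" by (intro card_mono pair_finite_verts)
    then show ?thesis using \<open>i \<noteq> j\<close> \<open>{i, j} \<subseteq> pverts G\<close> by (simp add: card_Diff_subset)
  qed
  ultimately show ?thesis using assms by (simp add: ridges_link link_iff)
qed

text \<open>
  A ridge \<open>(W, T)\<close> below the facets of \<open>i\<close> and \<open>j\<close> has \<open>W = {i, j}\<close> as its component and the two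
  vertices outside \<open>T\<close>; being connected, it is an edge. Conversely, an edge inside \<open>W0\<close> is such a ridge.
\<close>

lemma dual_graph_link:
  "dual_graph (lk (W0, T0)) graph_poset_le =
     \<lparr>pverts = vertex_facet G ` W0,
      parcs = map_prod (vertex_facet G) (vertex_facet G) ` (parcs G \<inter> W0 \<times> W0)\<rparr>"
proof -
  let ?R = "\<lambda>\<sigma> \<tau>. \<exists>\<rho>\<in>ridges (lk (W0, T0)) graph_poset_le.
      covered_by (lk (W0, T0)) graph_poset_le \<rho> \<sigma> \<and> covered_by (lk (W0, T0)) graph_poset_le \<rho> \<tau>"
  have arc_iff: "(i, j) \<in> parcs G \<longleftrightarrow> i \<noteq> j \<and> ?R (vertex_facet G i) (vertex_facet G j)"
    if ij: "i \<in> W0" "j \<in> W0" for i j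
  proof
    assume arc: "(i, j) \<in> parcs G"
    let ?\<rho> = "({i, j}, pverts G - {i, j})"
    have "?\<rho> \<in> ridges (lk (W0, T0)) graph_poset_le" using arc ij by (rule edge_face)
    moreover from this have "covered_by (lk (W0, T0)) graph_poset_le ?\<rho> (vertex_facet G k)"
      if "k \<in> {i, j}" for k
      using that covers_ridge by blast
    ultimately show "i \<noteq> j \<and> ?R (vertex_facet G i) (vertex_facet G j)"
      using pair_no_loops[OF arc] by auto
  next
    assume "i \<noteq> j \<and> ?R (vertex_facet G i) (vertex_facet G j)"
    then obtain W T where "i \<noteq> j" and ridge: "(W, T) \<in> ridges (lk (W0, T0)) graph_poset_le"
      and cov: "covered_by (lk (W0, T0)) graph_poset_le (W, T) (vertex_facet G i)"
        "covered_by (lk (W0, T0)) graph_poset_le (W, T) (vertex_facet G j)"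
      by auto
    have "vertex_facet G i \<in> vertex_facet G ` W" "vertex_facet G j \<in> vertex_facet G ` W"
      unfolding covers_ridge[OF ridge, symmetric] using cov by (auto simp: covered_by_def)
    then have W: "i \<in> W" "j \<in> W" using inj_vertex_facet by (auto dest: injD)
    have WT: "(W, T) \<in> graph_poset G" "card T + 2 = card (pverts G)"
      using ridge by (auto simp: ridges_link link_iff)
    have "j \<in> pverts G - T" using graph_posetD(3)[OF WT(1)] W(2) by blast
    moreover obtain k where "pverts G - T = {i, k}" using WT W(1) by (rule ridge_complement)
    ultimately have "pverts G - T = {i, j}" using \<open>i \<noteq> j\<close> by auto
    then have "j \<in> component_of G {i, j} i" using graph_posetD(4)[OF WT(1) W(1)] W(2) by simp
    then show "(i, j) \<in> parcs G" using \<open>i \<noteq> j\<close> by (rule component_of_pair)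
  qed
  have "{(\<sigma>, \<tau>). \<sigma> \<in> vertex_facet G ` W0 \<and> \<tau> \<in> vertex_facet G ` W0 \<and> \<sigma> \<noteq> \<tau> \<and> ?R \<sigma> \<tau>} =
      map_prod (vertex_facet G) (vertex_facet G) ` (parcs G \<inter> W0 \<times> W0)" (is "?A = ?B")
  proof (intro equalityI subsetI)
    fix p assume "p \<in> ?A"
    moreover obtain \<sigma> \<tau> where "p = (\<sigma>, \<tau>)" by (cases p)
    ultimately obtain i j where ij: "i \<in> W0" "j \<in> W0" "p = map_prod (vertex_facet G) (vertex_facet G) (i, j)"
      and "vertex_facet G i \<noteq> vertex_facet G j" "?R (vertex_facet G i) (vertex_facet G j)"
      unfolding mem_Collect_eq case_prod_conv map_prod_simp by blast
    then have "(i, j) \<in> parcs G" using arc_iff[OF ij(1,2)] by blast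
    then show "p \<in> ?B" using ij by blast
  next
    fix p assume "p \<in> ?B"
    then obtain i j where ij: "i \<in> W0" "j \<in> W0" "(i, j) \<in> parcs G"
      and p: "p = (vertex_facet G i, vertex_facet G j)" by auto
    then have "vertex_facet G i \<noteq> vertex_facet G j" "?R (vertex_facet G i) (vertex_facet G j)"
      using arc_iff[OF ij(1,2)] inj_vertex_facet by (blast dest: injD)+
    then show "p \<in> ?A" using ij(1,2) unfolding p by blast
  qed
  then show ?thesis unfolding dual_graph_def facets_link by simp
qed

lemma connected_dual_graph_link:
  "Digraph_Component.connected (with_proj (dual_graph (lk (W0, T0)) graph_poset_le))"
proof -
  let ?D = "with_proj (mk_symmetric (with_proj (dual_graph (lk (W0, T0)) graph_poset_le)))"
  have verts: "verts ?D = vertex_facet G ` W0" by (simp add: dual_graph_link)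
  have arcs: "(vertex_facet G u, vertex_facet G v) \<in> arcs_ends ?D"
    if "(u, v) \<in> parcs G" "u \<in> W0" "v \<in> W0" for u v
    using that by (force simp: dual_graph_link parcs_mk_symmetric)
  have "vertex_facet G u \<rightarrow>\<^sup>*\<^bsub>?D\<^esub> vertex_facet G v" if uv: "u \<in> W0" "v \<in> W0" for u v
  proof -
    obtain x where "W0 = component_of G (pverts G - T0) x" using base by (auto simp: graph_poset_iff)
    then have "u \<rightarrow>\<^sup>*\<^bsub>with_proj G \<restriction> W0\<^esub> v"
      using uv by (intro reachable_within_component[of "pverts G - T0"]) auto
    then show ?thesis
      unfolding reachable_def
    proof (induct rule: rtrancl_on_induct)
      case base
      then show ?case using uv verts by auto
    next
      case (step y z)
      then have "(y, z) \<in> parcs G" "y \<in> W0" "z \<in> W0" by (auto simp: arcs_ends_conv)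
      then show ?case
        using step(5) arcs[of y z] verts by (intro rtrancl_on_into_rtrancl_on[OF step(5)]) auto
    qed
  qed
  then show ?thesis
    unfolding Digraph_Component.connected_def strongly_connected_def verts
    using graph_posetD(2)[OF base] by auto
qed

lemma pseudomanifold_link: "pseudomanifold (lk (W0, T0)) graph_poset_le"
proof -
  have "card {\<sigma> \<in> lk (W0, T0). covered_by (lk (W0, T0)) graph_poset_le \<rho> \<sigma>} \<le> 2"
    if "\<rho> \<in> ridges (lk (W0, T0)) graph_poset_le" for \<rho>
  proof -
    obtain W T where \<rho>: "\<rho> = (W, T)" by (cases \<rho>)
    have WT: "(W, T) \<in> graph_poset G" "card T + 2 = card (pverts G)"
      using that by (auto simp: \<rho> ridges_link link_iff)
    have "W \<subseteq> pverts G - T" "T \<subseteq> pverts G" using graph_posetD(1,3)[OF WT(1)] by auto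
    then have "card W \<le> card (pverts G - T)" using pair_finite_verts by (intro card_mono) auto
    also have "\<dots> = 2"
      using WT(2) \<open>T \<subseteq> pverts G\<close> pair_finite_verts by (simp add: card_Diff_subset finite_subset)
    finally show ?thesis
      unfolding \<rho> covers_ridge[OF that[unfolded \<rho>]]
      using inj_vertex_facet by (simp add: card_image inj_on_subset)
  qed
  then show ?thesis
    unfolding pseudomanifold_def
    using simplicial_poset_link pure_link connected_dual_graph_link by blast
qed

lemma connected_poset_link:
  assumes "card T0 + 3 \<le> card (pverts G)"
  shows "connected_poset (lk (W0, T0)) graph_poset_le"
  using assms
  by (intro connected_poset_if_dual_graph_connected simplicial_poset_link connected_dual_graph_link)
    (simp add: poset_rank_link)

text \<open>
  For \<open>a \<in> W0\<close> and any other \<open>b\<close> outside \<open>T0\<close>, even one in a different component of \<open>G - T0\<close>, deleting all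
  vertices except \<open>a\<close> and \<open>b\<close> leaves a ridge of the link at the component of \<open>a\<close>. It is covered twice
  only if that component is \<open>{a, b}\<close>, that is, if \<open>a\<close> and \<open>b\<close> are adjacent. All ridges arise in this way.
\<close>

lemma without_boundary_link_iff:
  "without_boundary (lk (W0, T0)) graph_poset_le \<longleftrightarrow>
     (\<forall>a\<in>W0. \<forall>b\<in>pverts G - T0. a \<noteq> b \<longrightarrow> (a, b) \<in> parcs G)"
proof
  assume wb: "without_boundary (lk (W0, T0)) graph_poset_le"
  show "\<forall>a\<in>W0. \<forall>b\<in>pverts G - T0. a \<noteq> b \<longrightarrow> (a, b) \<in> parcs G"
  proof (intro ballI impI)
    fix a b assume a: "a \<in> W0" and b: "b \<in> pverts G - T0" and "a \<noteq> b"
    have a': "a \<in> pverts G - T0" using graph_posetD(3)[OF base] a by blast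
    let ?T = "pverts G - {a, b}" and ?W = "component_of G {a, b} a"
    have compl: "pverts G - ?T = {a, b}" using a' b by auto
    have W: "a \<in> ?W" "?W \<subseteq> {a, b}" using component_of_self component_of_subset by auto
    have WT: "(?W, ?T) \<in> graph_poset G" using a' b by (auto simp: graph_poset_iff compl)
    have "T0 \<subseteq> ?T" using graph_posetD(1)[OF base] a' b by auto
    then have "graph_poset_le (W0, T0) (?W, ?T)"
      using graph_poset_le_if_meet[OF base WT] a W(1) by blast
    moreover have "card ?T + 2 = card (pverts G)"
    proof -
      have "{a, b} \<subseteq> pverts G" using a' b by auto
      then have "card {a, b} \<le> card (pverts G)" by (intro card_mono pair_finite_verts)
      then show ?thesis using \<open>a \<noteq> b\<close> \<open>{a, b} \<subseteq> pverts G\<close> by (simp add: card_Diff_subset)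
    qed
    ultimately have ridge: "(?W, ?T) \<in> ridges (lk (W0, T0)) graph_poset_le"
      using WT unfolding ridges_link by (simp add: link_def)
    then have "card (vertex_facet G ` ?W) = 2"
      using wb covers_ridge[OF ridge] by (auto simp: without_boundary_def)
    then have "card ?W = 2" using inj_vertex_facet by (simp add: card_image inj_on_subset)
    then have "?W = {a, b}" using W(2) \<open>a \<noteq> b\<close> by (intro card_subset_eq) auto
    then show "(a, b) \<in> parcs G" using \<open>a \<noteq> b\<close> by (intro component_of_pair) auto
  qed
next
  assume adj: "\<forall>a\<in>W0. \<forall>b\<in>pverts G - T0. a \<noteq> b \<longrightarrow> (a, b) \<in> parcs G"
  have "card {\<sigma> \<in> lk (W0, T0). covered_by (lk (W0, T0)) graph_poset_le \<rho> \<sigma>} = 2"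
    if "\<rho> \<in> ridges (lk (W0, T0)) graph_poset_le" for \<rho>
  proof -
    obtain W T where \<rho>: "\<rho> = (W, T)" by (cases \<rho>)
    have WT: "(W, T) \<in> graph_poset G" "card T + 2 = card (pverts G)" "W \<subseteq> W0" "T0 \<subseteq> T"
      using that by (auto simp: \<rho> ridges_link link_iff)
    obtain a where a: "a \<in> W" using graph_posetD(2)[OF WT(1)] by blast
    obtain b where b: "b \<noteq> a" "pverts G - T = {a, b}" using ridge_complement[OF WT(1,2) a] by blast
    have "b \<in> pverts G - T0" using b(2) WT(4) by blast
    moreover have "a \<in> W0" using a WT(3) by blast
    ultimately have "(a, b) \<in> parcs G" using adj b(1) by simp
    then have "b \<in> component_of G {a, b} a" by (rule component_of_adjacent) auto
    then have "b \<in> W" using graph_posetD(4)[OF WT(1) a] b(2) by simp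
    then have "W = {a, b}" using graph_posetD(3)[OF WT(1)] a b(2) by auto
    then have "card W = 2" using b(1) by simp
    then show ?thesis
      unfolding \<rho> covers_ridge[OF that[unfolded \<rho>]]
      using inj_vertex_facet by (simp add: card_image inj_on_subset)
  qed
  then show "without_boundary (lk (W0, T0)) graph_poset_le" by (simp add: without_boundary_def)
qed

end

text \<open>
  A link inside a link is again a link of the whole poset (\<open>link_link\<close>), so normality reduces to the
  connectedness already shown for all links of rank at least 2.
\<close>

lemma normal_pseudomanifold_link:
  assumes "(W, T) \<in> graph_poset G"
  shows "normal_pseudomanifold (lk (W, T)) graph_poset_le"
  unfolding normal_pseudomanifold_def
proof (intro conjI ballI impI)
  show "pseudomanifold (lk (W, T)) graph_poset_le" using assms by (rule pseudomanifold_link)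
  fix \<sigma> assume \<sigma>: "\<sigma> \<in> lk (W, T)"
    and r: "rank (lk (W, T)) graph_poset_le \<sigma> + 2 \<le> poset_rank (lk (W, T)) graph_poset_le"
  obtain W' T' where eq: "\<sigma> = (W', T')" by (cases \<sigma>)
  have W'T': "(W', T') \<in> graph_poset G" "T \<subseteq> T'" using \<sigma> by (auto simp: eq link_iff)
  have "T' \<subseteq> pverts G" using graph_posetD(1)[OF W'T'(1)] by blast
  then have "card T \<le> card T'" using W'T'(2) pair_finite_verts by (meson card_mono finite_subset)
  then have "card T' + 3 \<le> card (pverts G)"
    using r \<sigma> by (simp add: eq rank_link[OF assms] poset_rank_link[OF assms])
  then show "connected_poset (link (lk (W, T)) graph_poset_le \<sigma>) graph_poset_le"
    unfolding link_link[OF \<sigma>] using W'T'(1) by (simp add: eq connected_poset_link)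
qed

lemma clique_iff:
  "clique G W \<longleftrightarrow> W \<subseteq> pverts G \<and> (\<forall>a\<in>W. \<forall>b\<in>W. a \<noteq> b \<longrightarrow> (a, b) \<in> parcs G)"
proof -
  have "complete_digraph (card W) (with_proj G \<restriction> W) \<longleftrightarrow> (\<forall>a\<in>W. \<forall>b\<in>W. a \<noteq> b \<longrightarrow> (a, b) \<in> parcs G)"
    if "W \<subseteq> pverts G"
  proof -
    have ind: "induced_subgraph (with_proj G \<restriction> W) (with_proj G)" using that by auto
    interpret H: digraph "with_proj G \<restriction> W" using ind by (rule digraphI_induced)
    have "symmetric (with_proj G \<restriction> W)" using sym_arcs ind by (rule induced_graph_imp_symmetric)
    then have "graph (with_proj G \<restriction> W)" ..
    moreover have "arcs_ends (with_proj G \<restriction> W) = parcs G \<inter> W \<times> W" by (force simp: arcs_ends_conv)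
    ultimately show ?thesis
      using pair_no_loops unfolding complete_digraph_def by fastforce
  qed
  then show ?thesis by (auto simp: clique_def)
qed

lemma without_boundary_iff_clique:
  assumes "(W, T) \<in> graph_poset G"
  shows "without_boundary (lk (W, T)) graph_poset_le \<longleftrightarrow> clique G W \<and> T = pverts G - W"
  unfolding without_boundary_link_iff[OF assms] clique_iff
proof
  have W: "W \<subseteq> pverts G - T" "T \<subseteq> pverts G" "W \<noteq> {}" using graph_posetD(1,2,3)[OF assms] by auto
  assume adj: "\<forall>a\<in>W. \<forall>b\<in>pverts G - T. a \<noteq> b \<longrightarrow> (a, b) \<in> parcs G"
  obtain a where a: "a \<in> W" using W by blast
  have "b \<in> W" if b: "b \<in> pverts G - T" for b
  proof (cases "a = b")
    case False
    then have "(a, b) \<in> parcs G" using adj a b by simp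
    then have "b \<in> component_of G (pverts G - T) a" using a W b by (intro component_of_adjacent) auto
    then show ?thesis using graph_posetD(4)[OF assms a] by simp
  qed (use a in simp)
  then have "W = pverts G - T" using W(1) by blast
  then show "(W \<subseteq> pverts G \<and> (\<forall>a\<in>W. \<forall>b\<in>W. a \<noteq> b \<longrightarrow> (a, b) \<in> parcs G)) \<and> T = pverts G - W"
    using adj W(2) by auto
next
  assume "(W \<subseteq> pverts G \<and> (\<forall>a\<in>W. \<forall>b\<in>W. a \<noteq> b \<longrightarrow> (a, b) \<in> parcs G)) \<and> T = pverts G - W"
  moreover from this have "pverts G - T = W" by blast
  ultimately show "\<forall>a\<in>W. \<forall>b\<in>pverts G - T. a \<noteq> b \<longrightarrow> (a, b) \<in> parcs G" by simp
qed

lemma link_bottom: "lk (pverts G, {}) = graph_poset G"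
  using graph_posetD(3) by (auto simp: link_iff) blast

text \<open>
  A facet \<open>({i}, V - {i})\<close> satisfies the clique condition, so the clause that declares facets interior
  agrees with the condition on the link.
\<close>

lemma interior_face_iff:
  assumes "(W, T) \<in> graph_poset G" "(pverts G, {}) \<in> graph_poset G"
  shows "interior_face (graph_poset G) graph_poset_le (W, T) \<longleftrightarrow> clique G W \<and> T = pverts G - W"
proof -
  have "without_boundary (lk (W, T)) graph_poset_le" if "(W, T) \<in> facets (graph_poset G) graph_poset_le"
  proof -
    have "(W, T) \<in> vertex_facet G ` pverts G"
      using that facets_link[OF assms(2)] by (simp add: link_bottom)
    then obtain i where "W = {i}" "T = pverts G - {i}" by (auto simp: vertex_facet_def)
    moreover then have "i \<in> pverts G" using graph_posetD(3)[OF assms(1)] by blast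
    ultimately show ?thesis using without_boundary_iff_clique[OF assms(1)] by (simp add: clique_iff)
  qed
  then show ?thesis
    unfolding interior_face_def without_boundary_iff_clique[OF assms(1), symmetric]
    using assms(1) normal_pseudomanifold_link[OF assms(1)] by blast
qed

lemma bottom_in_graph_poset:
  assumes "Digraph_Component.connected (with_proj G)"
  shows "(pverts G, {}) \<in> graph_poset G"
proof -
  have "strongly_connected (with_proj G)"
    using sym_arcs assms by (rule symmetric_connected_imp_strongly_connected)
  moreover have "with_proj G \<restriction> pverts G = with_proj G"
    using arc_fst_in_verts arc_snd_in_verts by (intro pre_digraph.equality) fastforce+
  ultimately obtain x where x: "x \<in> pverts G" and reach: "pverts G \<subseteq> component_of G (pverts G) x"
    by (auto simp: strongly_connected_def component_of_def)
  have "component_of G (pverts G) x = pverts G" using reach component_of_subset[of "pverts G" x] by blast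
  then show ?thesis using x by (auto simp: graph_poset_iff)
qed

end

section \<open>The poset of a connected graph\<close>

theorem proposition3p6:
  fixes G :: "nat pair_pre_digraph" and l :: nat
  assumes "l \<ge> 1"
    and "pair_graph G"
    and "pverts G = {1..l}"
    and "Digraph_Component.connected (with_proj G)"
  shows "normal_pseudomanifold (graph_poset G) graph_poset_le \<and>
         poset_rank (graph_poset G) graph_poset_le = l - 1 \<and>
         inj_on (vertex_facet G) {1..l} \<and>
         dual_graph (graph_poset G) graph_poset_le =
           \<lparr>pverts = vertex_facet G ` {1..l},
            parcs = map_prod (vertex_facet G) (vertex_facet G) ` parcs G\<rparr> \<and>
         (\<forall>W T. (W, T) \<in> graph_poset G \<longrightarrow>
            (interior_face (graph_poset G) graph_poset_le (W, T) \<longleftrightarrow>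
             clique G W \<and> T = {1..l} - W))"
proof -
  interpret pair_graph G by fact
  have bot: "(pverts G, {}) \<in> graph_poset G" using assms(4) by (rule bottom_in_graph_poset)
  have "parcs G \<inter> pverts G \<times> pverts G = parcs G"
    using arc_fst_in_verts arc_snd_in_verts by fastforce
  then have "dual_graph (graph_poset G) graph_poset_le =
      \<lparr>pverts = vertex_facet G ` pverts G, parcs = map_prod (vertex_facet G) (vertex_facet G) ` parcs G\<rparr>"
    using dual_graph_link[OF bot] by (simp add: link_bottom)
  moreover have "normal_pseudomanifold (graph_poset G) graph_poset_le"
    using normal_pseudomanifold_link[OF bot] by (simp add: link_bottom)
  moreover have "poset_rank (graph_poset G) graph_poset_le = l - 1"
    using poset_rank_link[OF bot] by (simp add: link_bottom) (simp add: assms(3))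
  moreover have "inj_on (vertex_facet G) {1..l}"
    using inj_vertex_facet by (rule inj_on_subset) simp
  ultimately show ?thesis using interior_face_iff[OF _ bot] assms(3) by simp
qed

end
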